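(* Let $M\succeq\rho\mathcal A^T\mathcal A+LI_n$. The algorithmic map defined by $$z^+=\mathrm{Prim}_t(z,\lambda)\equiv\operatorname{argmin}_{\xi}\left\{f(\xi)+\langle\nabla h(z),\xi\rangle+\langle\lambda,\mathcal A\xi-b\rangle+\rho_t\langle\mathcal A z-b,\mathcal A\xi\rangle+\frac{\tau_t}{2}\|\xi-z\|_M^2\right\}$$ is nice with $\delta=1$, $P=M-\rho\mathcal A^T\mathcal A$ and $Q=M-\rho\mathcal A^T\mathcal A-LI_n$.
   Context: **Problem.** Let $f:\mathbb R^n\to(-\infty,+\infty]$ be proper, lower semicontinuous and $\sigma$-strongly convex with $\sigma\ge0$ ($\sigma=0$ means merely convex), and let $h:\mathbb R^n\to\mathbb R$ be convex and continuously differentiable with $L$-Lipschitz continuous gradient. Let $\Psi=f+h$, $\mathcal A:\mathbb R^n\to\mathbb R^m$ linear, $b\in\mathbb R^m$; the problem is $\min\{\Psi(x):\mathcal A x=b,\ x\in\mathbb R^n\}$, with feasible set $\mathcal F=\{x\in\mathbb R^n:\mathcal A x=b\}$. For $\rho\ge0$ the augmented Lagrangian is $\mathcal L_\rho(x,y)=\Psi(x)+\langle y,\mathcal A x-b\rangle+\frac\rho2\|\mathcal A x-b\|^2$. Standing assumption: the Lagrangian $\mathcal L_0$ has a saddle point, i.e. there is $(x^*,y^* )$ with $\mathcal L_0(x^*,y)\le\mathcal L_0(x^*,y^* )\le\mathcal L_0(x,y^* )$ for all $x,y$. **Notation.** $\mathbb S_+^n$ is the set of $n\times n$ symmetric positive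 semidefinite matrices; $M\succeq N$ means $M-N\in\mathbb S_+^n$; $I_n$ is the identity matrix. For $P\in\mathbb S_+^n$, $\|u\|_P=\sqrt{\langle u,Pu\rangle}$ and $\Delta_P(u,v,w)=\frac12(\|u-v\|_P^2-\|u-w\|_P^2)$. **Nice primal algorithmic map.** Given parameters $\rho,t>0$, let $\rho_t=\rho$ and $\tau_t=1$ when $\sigma=0$, and $\rho_t=\rho t$ and $\tau_t=t$ when $\sigma>0$. A primal algorithmic map $\mathrm{Prim}_t:\mathbb R^n\times\mathbb R^m\to\mathbb R^n$, applied on the augmented Lagrangian $\mathcal L_{\rho_t}(z,\lambda)$, that generates $z^+$ via $z^+\in\mathrm{Prim}_t(z,\lambda)$, is called nice if there exist $\delta\in(0,1]$ and matrices $P,Q\in\mathbb S_+^n$ such that for any $\xi\in\mathcal F$, $$\mathcal L_{\rho_t}(z^+,\lambda)-\mathcal L_{\rho_t}(\xi,\lambda)\le\tau_t\Delta_P(\xi,z,z^+)-\frac{\tau_t}{2}\|z^+-z\|_Q^2-\frac{\sigma}{2}\|\xi-z^+\|^2-\frac{\delta\rho_t}{2}\|\mathcal A z^+-b\|^2.$$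
   Formalization: The formal statement additionally assumes t ≥ 1 when σ > 0 and L > 0; for t < 1 the claim is false, e.g. n = m = 1, A = 0, b = 0, σ = L = M = 1, f = h = x²/2, t = 1/10, z = 1, ξ = 0. *)

theory Defs
  imports "HOL-Analysis.Analysis"
begin

definition proper_fun :: "('a \<Rightarrow> ereal) \<Rightarrow> bool" where
  "proper_fun f \<longleftrightarrow> (\<forall>x. f x \<noteq> -\<infinity>) \<and> (\<exists>x. f x \<noteq> \<infinity>)"

definition lower_semicont :: "('a::topological_space \<Rightarrow> ereal) \<Rightarrow> bool" where
  "lower_semicont f \<longleftrightarrow> (\<forall>x. f x \<le> Liminf (at x) f)"

(* The case s = 0 is ordinary convexity.  The quadratic term is added on the left, and in
   ereal 0 * \<infinity> = 0, so no undetermined form arises for a function that avoids -\<infinity>. *)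
definition strongly_convex :: "real \<Rightarrow> ('a::real_inner \<Rightarrow> ereal) \<Rightarrow> bool" where
  "strongly_convex s f \<longleftrightarrow>
    (\<forall>x y. \<forall>u\<ge>0. \<forall>v\<ge>0. u + v = 1 \<longrightarrow>
       f (u *\<^sub>R x + v *\<^sub>R y) + ereal (s / 2 * u * v * (norm (x - y))\<^sup>2)
         \<le> ereal u * f x + ereal v * f y)"

definition psd :: "real ^ 'n ^ 'n \<Rightarrow> bool" where
  "psd P \<longleftrightarrow> transpose P = P \<and> (\<forall>x. 0 \<le> x \<bullet> (P *v x))"

definition loewner_ge :: "real ^ 'n ^ 'n \<Rightarrow> real ^ 'n ^ 'n \<Rightarrow> bool" where
  "loewner_ge M N \<longleftrightarrow> psd (M - N)"

definition mnorm :: "real ^ 'n ^ 'n \<Rightarrow> real ^ 'n \<Rightarrow> real" where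
  "mnorm P u = sqrt (u \<bullet> (P *v u))"

definition Delta :: "real ^ 'n ^ 'n \<Rightarrow> real ^ 'n \<Rightarrow> real ^ 'n \<Rightarrow> real ^ 'n \<Rightarrow> real" where
  "Delta P u v w = 1 / 2 * ((mnorm P (u - v))\<^sup>2 - (mnorm P (u - w))\<^sup>2)"

definition feasible :: "real ^ 'n ^ 'm \<Rightarrow> real ^ 'm \<Rightarrow> (real ^ 'n) set" where
  "feasible A b = {x. A *v x = b}"

definition aug_lagrangian ::
  "(real ^ 'n \<Rightarrow> ereal) \<Rightarrow> (real ^ 'n \<Rightarrow> real) \<Rightarrow> real ^ 'n ^ 'm \<Rightarrow> real ^ 'm \<Rightarrow> real
     \<Rightarrow> real ^ 'n \<Rightarrow> real ^ 'm \<Rightarrow> ereal" where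
  "aug_lagrangian f h A b r x y =
     (f x + ereal (h x)) + ereal (y \<bullet> (A *v x - b)) + ereal (r / 2 * (norm (A *v x - b))\<^sup>2)"

definition has_saddle_point ::
  "(real ^ 'n \<Rightarrow> ereal) \<Rightarrow> (real ^ 'n \<Rightarrow> real) \<Rightarrow> real ^ 'n ^ 'm \<Rightarrow> real ^ 'm \<Rightarrow> bool" where
  "has_saddle_point f h A b \<longleftrightarrow>
     (\<exists>xs ys. \<forall>x y.
        aug_lagrangian f h A b 0 xs y \<le> aug_lagrangian f h A b 0 xs ys \<and>
        aug_lagrangian f h A b 0 xs ys \<le> aug_lagrangian f h A b 0 x ys)"

definition rho_t :: "real \<Rightarrow> real \<Rightarrow> real \<Rightarrow> real" where
  "rho_t \<sigma> \<rho> t = (if \<sigma> = 0 then \<rho> else \<rho> * t)"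

definition tau_t :: "real \<Rightarrow> real \<Rightarrow> real" where
  "tau_t \<sigma> t = (if \<sigma> = 0 then 1 else t)"

(* A primal algorithmic map is set-valued: it sends (z, \<lambda>) to the set of admissible z\<^sup>+.
   It is nice when this predicate holds for some \<delta>, P, Q, which depend neither on the point
   (z, \<lambda>) nor on the choice of z\<^sup>+ and \<xi>. *)
definition nice_with ::
  "(real ^ 'n \<Rightarrow> ereal) \<Rightarrow> (real ^ 'n \<Rightarrow> real) \<Rightarrow> real ^ 'n ^ 'm \<Rightarrow> real ^ 'm
     \<Rightarrow> real \<Rightarrow> real \<Rightarrow> real \<Rightarrow> (real ^ 'n \<Rightarrow> real ^ 'm \<Rightarrow> (real ^ 'n) set)
     \<Rightarrow> real \<Rightarrow> real ^ 'n ^ 'n \<Rightarrow> real ^ 'n ^ 'n \<Rightarrow> bool" where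
  "nice_with f h A b \<sigma> \<rho> t Prim \<delta> P Q \<longleftrightarrow>
     \<delta> \<in> {0<..1} \<and> psd P \<and> psd Q \<and>
     (\<forall>z l. \<forall>zp \<in> Prim z l. \<forall>\<xi> \<in> feasible A b.
        aug_lagrangian f h A b (rho_t \<sigma> \<rho> t) zp l - aug_lagrangian f h A b (rho_t \<sigma> \<rho> t) \<xi> l
          \<le> ereal (tau_t \<sigma> t * Delta P \<xi> z zp
                   - tau_t \<sigma> t / 2 * (mnorm Q (zp - z))\<^sup>2
                   - \<sigma> / 2 * (norm (\<xi> - zp))\<^sup>2
                   - \<delta> * rho_t \<sigma> \<rho> t / 2 * (norm (A *v zp - b))\<^sup>2))"

(* gh stands for the gradient of h. *)
definition prim_linearized ::
  "(real ^ 'n \<Rightarrow> ereal) \<Rightarrow> (real ^ 'n \<Rightarrow> real ^ 'n) \<Rightarrow> real ^ 'n ^ 'm \<Rightarrow> real ^ 'm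
     \<Rightarrow> real \<Rightarrow> real \<Rightarrow> real \<Rightarrow> real ^ 'n ^ 'n \<Rightarrow> real ^ 'n \<Rightarrow> real ^ 'm \<Rightarrow> (real ^ 'n) set" where
  "prim_linearized f gh A b \<sigma> \<rho> t M z l =
     {zp. is_arg_min
        (\<lambda>\<xi>. f \<xi> + ereal (gh z \<bullet> \<xi> + l \<bullet> (A *v \<xi> - b)
                          + rho_t \<sigma> \<rho> t * ((A *v z - b) \<bullet> (A *v \<xi>))
                          + tau_t \<sigma> t / 2 * (mnorm M (\<xi> - z))\<^sup>2))
        (\<lambda>_. True) zp}"

end

theory Submission
  imports Defs
begin

text \<open>
  The quadratic term of the subproblem and the strong convexity of \<open>f\<close> make the objective
  grow at least like \<open>\<sigma>/2 \<parallel>\<xi> - z\<^sup>+\<parallel>\<^sup>2 + \<tau>/2 \<parallel>\<xi> - z\<^sup>+\<parallel>\<^sub>M\<^sup>2\<close> away from its minimizer \<open>z\<^sup>+\<close>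
  (\<open>arg_min_quadratic_growth\<close>).  At a feasible \<open>\<xi>\<close> this bounds
  \<open>f z\<^sup>+ - f \<xi>\<close> by the linearized terms together with
  \<open>\<tau>/2 (\<parallel>\<xi> - z\<parallel>\<^sub>M\<^sup>2 - \<parallel>\<xi> - z\<^sup>+\<parallel>\<^sub>M\<^sup>2 - \<parallel>z\<^sup>+ - z\<parallel>\<^sub>M\<^sup>2) - \<sigma>/2 \<parallel>\<xi> - z\<^sup>+\<parallel>\<^sup>2\<close>.

  Two linearizations have to be paid for.  Replacing \<open>h\<close> by its tangent at \<open>z\<close> costs
  \<open>L/2 \<parallel>z\<^sup>+ - z\<parallel>\<^sup>2\<close>, by the descent lemma at \<open>z\<^sup>+\<close> and convexity at \<open>\<xi>\<close>
  (\<open>linearization_error\<close>).  Replacing the penalty by its gradient at \<open>z\<close> leaves, with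
  \<open>a = A z - b\<close> and \<open>a' = A z\<^sup>+ - b\<close>, the exact remainder
  \<open>\<parallel>a'\<parallel>\<^sup>2/2 - a \<bullet> a' = (\<parallel>a'\<parallel>\<^sup>2 - \<parallel>a\<parallel>\<^sup>2 + \<parallel>a' - a\<parallel>\<^sup>2)/2 - \<parallel>a'\<parallel>\<^sup>2/2\<close> times \<open>\<rho>\<^sub>t\<close>.
  Since \<open>\<rho>\<^sub>t = \<tau>\<^sub>t \<rho>\<close>, the bracket is what turns the three \<open>M\<close>-norms into norms for
  \<open>M - \<rho> A\<^sup>T A\<close>, and the last term is the residual with \<open>\<delta> = 1\<close>.  The error of \<open>h\<close>
  is absorbed by the summand \<open>-L I\<close> of \<open>Q\<close>, whose weight \<open>\<tau>\<^sub>t L\<close> is at least \<open>L\<close>: either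
  \<open>\<tau>\<^sub>t = 1\<close>, or \<open>L = 0\<close>, or \<open>\<tau>\<^sub>t = t \<ge> 1\<close>.
\<close>

section \<open>Smooth convex functions\<close>

lemma GDERIV_along_line:
  fixes h :: "'a::real_inner \<Rightarrow> real"
  assumes "\<And>x. GDERIV h x :> gh x"
  shows "((\<lambda>s. h (z + s *\<^sub>R d)) has_real_derivative gh (z + s *\<^sub>R d) \<bullet> d) (at s)"
proof -
  have h: "(h has_derivative (\<lambda>v. v \<bullet> gh (z + s *\<^sub>R d))) (at (z + s *\<^sub>R d))"
    using assms unfolding gderiv_def by blast
  have "((\<lambda>s. z + s *\<^sub>R d) has_derivative (\<lambda>s. s *\<^sub>R d)) (at s)"
    by (auto intro!: derivative_eq_intros)
  from has_derivative_compose[OF this h] show ?thesis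
    unfolding has_field_derivative_def
    by (rule has_derivative_eq_rhs) (simp add: fun_eq_iff inner_commute)
qed

text \<open>
  The derivative of \<open>h\<close> along the segment exceeds its initial value by at most
  \<open>L s \<parallel>d\<parallel>\<^sup>2\<close> at parameter \<open>s\<close>, so \<open>h\<close> minus its quadratic model is nonincreasing.
\<close>
lemma descent_lemma:
  fixes h :: "'a::real_inner \<Rightarrow> real"
  assumes gd: "\<And>x. GDERIV h x :> gh x" and lip: "L-lipschitz_on UNIV gh"
  shows "h y \<le> h z + gh z \<bullet> (y - z) + L / 2 * (norm (y - z))\<^sup>2"
proof -
  define d where "d = y - z"
  define \<phi> where "\<phi> s = h (z + s *\<^sub>R d) - s * (gh z \<bullet> d) - L / 2 * s\<^sup>2 * (norm d)\<^sup>2" for s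
  have "\<phi> 1 \<le> \<phi> 0"
  proof (rule DERIV_nonpos_imp_nonincreasing[of 0 1 \<phi>])
    fix s :: real assume s: "0 \<le> s"
    have "(\<phi> has_real_derivative
        gh (z + s *\<^sub>R d) \<bullet> d - gh z \<bullet> d - L * s * (norm d)\<^sup>2) (at s)"
      unfolding \<phi>_def by (auto intro!: derivative_eq_intros GDERIV_along_line gd)
    moreover have "gh (z + s *\<^sub>R d) \<bullet> d - gh z \<bullet> d \<le> L * s * (norm d)\<^sup>2"
    proof -
      have "gh (z + s *\<^sub>R d) \<bullet> d - gh z \<bullet> d \<le> norm (gh (z + s *\<^sub>R d) - gh z) * norm d"
        by (metis inner_diff_left norm_cauchy_schwarz)
      also have "\<dots> \<le> (L * (s * norm d)) * norm d"
        using lipschitz_onD[OF lip, of "z + s *\<^sub>R d" z] s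
        by (intro mult_right_mono) (simp_all add: dist_norm)
      finally show ?thesis by (simp add: power2_eq_square mult.assoc)
    qed
    ultimately show "\<exists>D. (\<phi> has_real_derivative D) (at s) \<and> D \<le> 0" by force
  qed simp
  then show ?thesis by (simp add: \<phi>_def d_def)
qed

lemma convex_above_gradient_tangent:
  fixes h :: "'a::real_inner \<Rightarrow> real"
  assumes gd: "\<And>x. GDERIV h x :> gh x" and conv: "convex_on UNIV h"
  shows "h z + gh z \<bullet> (x - z) \<le> h x"
proof -
  define \<phi> where "\<phi> s = h (z + s *\<^sub>R (x - z))" for s
  have "convex_on UNIV \<phi>"
  proof (rule convex_onI)
    fix u s s' :: real assume u: "0 < u" "u < 1"
    have "z + ((1 - u) *\<^sub>R s + u *\<^sub>R s') *\<^sub>R (x - z)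
        = (1 - u) *\<^sub>R (z + s *\<^sub>R (x - z)) + u *\<^sub>R (z + s' *\<^sub>R (x - z))"
      by (simp add: algebra_simps)
    then show "\<phi> ((1 - u) *\<^sub>R s + u *\<^sub>R s') \<le> (1 - u) * \<phi> s + u * \<phi> s'"
      unfolding \<phi>_def using convex_onD[OF conv, of u] u by simp
  qed simp
  moreover have "(\<phi> has_real_derivative gh z \<bullet> (x - z)) (at 0)"
    unfolding \<phi>_def using GDERIV_along_line[OF gd, of z "x - z" 0] by simp
  ultimately have "\<phi> 1 - \<phi> 0 \<ge> (gh z \<bullet> (x - z)) * (1 - 0)"
    by (intro convex_on_imp_above_tangent[of UNIV]) auto
  then show ?thesis by (simp add: \<phi>_def)
qed

lemma linearization_error:
  fixes h :: "'a::real_inner \<Rightarrow> real"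
  assumes "\<And>x. GDERIV h x :> gh x" "convex_on UNIV h" "L-lipschitz_on UNIV gh"
  shows "h y - h x \<le> gh z \<bullet> (y - x) + L / 2 * (norm (y - z))\<^sup>2"
  using descent_lemma[OF assms(1,3), of y z] convex_above_gradient_tangent[OF assms(1,2), of z x]
  by (simp add: inner_diff_right)

section \<open>Quadratic forms\<close>

lemma psd_mnorm_sq: "psd P \<Longrightarrow> (mnorm P u)\<^sup>2 = u \<bullet> (P *v u)"
  by (simp add: mnorm_def psd_def)

lemma psd_add: "psd P \<Longrightarrow> psd Q \<Longrightarrow> psd (P + Q)"
  by (simp add: psd_def matrix_vector_mult_add_rdistrib inner_add_right transpose_def vec_eq_iff)

lemma psd_scaleR: "0 \<le> c \<Longrightarrow> psd P \<Longrightarrow> psd (c *\<^sub>R P)"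
  by (simp add: psd_def scaleR_matrix_vector_assoc[symmetric] transpose_def vec_eq_iff)

lemma psd_mat_1: "psd (mat 1)"
  by (simp add: psd_def)

lemma inner_gram: "x \<bullet> ((transpose A ** A) *v x) = (norm (A *v x))\<^sup>2"
  for A :: "real ^ 'n ^ 'm"
  by (metis dot_lmul_matrix inner_commute matrix_vector_mul_assoc power2_norm_eq_inner
      transpose_matrix_vector)

lemma psd_gram: "psd (transpose A ** A)" for A :: "real ^ 'n ^ 'm"
  by (simp add: psd_def inner_gram matrix_transpose_mul transpose_transpose)

text \<open>
  A quadratic form is strongly convex relative to itself, with equality.
\<close>
lemma quadratic_form_segment:
  fixes M :: "real ^ 'n ^ 'n"
  shows "((1 - u) *\<^sub>R x + u *\<^sub>R y) \<bullet> (M *v ((1 - u) *\<^sub>R x + u *\<^sub>R y))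
    = (1 - u) * (x \<bullet> (M *v x)) + u * (y \<bullet> (M *v y)) - u * (1 - u) * ((y - x) \<bullet> (M *v (y - x)))"
  by (simp add: matrix_vector_right_distrib matrix_vector_mult_diff_distrib
      matrix_vector_mult_scaleR inner_add_left inner_add_right inner_diff_left inner_diff_right)
    (simp add: algebra_simps)

section \<open>Growth at the minimizer\<close>

lemma is_arg_min_UNIV_le:
  fixes F :: "'a \<Rightarrow> 'b::linorder"
  shows "is_arg_min F (\<lambda>_. True) x \<Longrightarrow> F x \<le> F y"
  by (simp add: is_arg_min_def not_less)

lemma arg_min_proper_finite:
  assumes "proper_fun f" "is_arg_min (\<lambda>x. f x + ereal (q x)) (\<lambda>_. True) p"
  shows "\<bar>f p\<bar> \<noteq> \<infinity>"
proof -
  obtain x where "f x \<noteq> \<infinity>" using assms(1) by (auto simp: proper_fun_def)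
  moreover have "f p + ereal (q p) \<le> f x + ereal (q x)"
    using is_arg_min_UNIV_le[OF assms(2)] .
  ultimately show ?thesis
    using assms(1) unfolding proper_fun_def by (cases "f x"; cases "f p") auto
qed

text \<open>
  Comparing the minimizer \<open>p\<close> with the point at parameter \<open>u\<close> of the segment to \<open>x\<close> gives
  the claim with the growth term multiplied by \<open>1 - u\<close>; then \<open>u\<close> tends to \<open>0\<close>.  The smooth
  part \<open>q\<close> enters only through its convexity modulus \<open>K\<close> on this segment.
\<close>
lemma arg_min_quadratic_growth:
  fixes f :: "'a::real_inner \<Rightarrow> ereal"
  assumes sc: "strongly_convex \<sigma> f"
    and min: "is_arg_min (\<lambda>x. f x + ereal (q x)) (\<lambda>_. True) p"
    and fp: "f p = ereal a" and fx: "f x = ereal c"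
    and q: "\<And>u. 0 < u \<Longrightarrow> u < 1 \<Longrightarrow>
      q ((1 - u) *\<^sub>R p + u *\<^sub>R x) \<le> (1 - u) * q p + u * q x - u * (1 - u) * K"
  shows "a + q p + \<sigma> / 2 * (norm (x - p))\<^sup>2 + K \<le> c + q x"
proof -
  define G where "G = \<sigma> / 2 * (norm (x - p))\<^sup>2 + K"
  have step: "a + q p + (1 - u) * G \<le> c + q x" if u: "0 < u" "u < 1" for u
  proof -
    let ?w = "(1 - u) *\<^sub>R p + u *\<^sub>R x"
    have "f ?w + ereal (\<sigma> / 2 * (1 - u) * u * (norm (p - x))\<^sup>2)
        \<le> ereal (1 - u) * f p + ereal u * f x"
      using sc u unfolding strongly_convex_def by auto
    moreover have "ereal (a + q p) \<le> f ?w + ereal (q ?w)"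
      using is_arg_min_UNIV_le[OF min, of ?w] fp by simp
    ultimately have "a + q p \<le> (1 - u) * a + u * c
        - \<sigma> / 2 * (1 - u) * u * (norm (p - x))\<^sup>2 + q ?w"
      by (cases "f ?w") (auto simp: fp fx)
    also have "\<dots> \<le> (1 - u) * (a + q p) + u * (c + q x) - u * ((1 - u) * G)"
      using q[OF u] by (simp add: G_def norm_minus_commute algebra_simps)
    finally have "u * (a + q p + (1 - u) * G) \<le> u * (c + q x)"
      by (simp add: algebra_simps)
    then show ?thesis using u by simp
  qed
  have "((\<lambda>u. a + q p + (1 - u) * G) \<longlongrightarrow> a + q p + (1 - 0) * G) (at_right 0)"
    by (intro tendsto_intros)
  moreover have "eventually (\<lambda>u. a + q p + (1 - u) * G \<le> c + q x) (at_right 0)"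
    by (rule eventually_mono[OF eventually_at_right_real[of 0 1]]) (auto intro: step)
  ultimately have "a + q p + (1 - 0) * G \<le> c + q x"
    by (intro tendsto_upperbound) auto
  then show ?thesis by (simp add: G_def)
qed

section \<open>The linearized primal step\<close>

text \<open>
  Growth of the subproblem at its minimizer \<open>p\<close>, with the linear terms collected into one
  covector \<open>c\<close>.
\<close>
lemma proximal_three_point:
  fixes f :: "real ^ 'n \<Rightarrow> ereal" and M :: "real ^ 'n ^ 'n"
  assumes sc: "strongly_convex \<sigma> f"
    and min: "is_arg_min
      (\<lambda>x. f x + ereal (c \<bullet> x + e + \<tau> / 2 * ((x - z) \<bullet> (M *v (x - z))))) (\<lambda>_. True) p"
    and fp: "f p = ereal a" and fx: "f x = ereal d"
  shows "a - d \<le> c \<bullet> (x - p)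
      + \<tau> / 2 * ((x - z) \<bullet> (M *v (x - z)) - (p - z) \<bullet> (M *v (p - z)) - (x - p) \<bullet> (M *v (x - p)))
      - \<sigma> / 2 * (norm (x - p))\<^sup>2"
proof -
  define m where "m v = v \<bullet> (M *v v)" for v
  let ?q = "\<lambda>x. c \<bullet> x + e + \<tau> / 2 * m (x - z)"
  have q: "?q ((1 - u) *\<^sub>R p + u *\<^sub>R x)
      \<le> (1 - u) * ?q p + u * ?q x - u * (1 - u) * (\<tau> / 2 * m (x - p))" for u
  proof -
    have "(1 - u) *\<^sub>R p + u *\<^sub>R x - z = (1 - u) *\<^sub>R (p - z) + u *\<^sub>R (x - z)"
      by (simp add: algebra_simps)
    then show ?thesis
      using quadratic_form_segment[of u "p - z" "x - z" M, folded m_def]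
      by (simp add: inner_add_right) (simp add: algebra_simps add_divide_distrib diff_divide_distrib)
  qed
  from arg_min_quadratic_growth[OF sc min[folded m_def] fp fx q]
  show ?thesis unfolding m_def[symmetric] by (simp add: inner_diff_right algebra_simps)
qed

text \<open>
  In this form the step parameters are an arbitrary \<open>\<tau>\<close> with \<open>L \<le> \<tau> L\<close> and the penalty
  \<open>\<tau> \<rho>\<close>, which covers both the merely convex and the strongly convex regime.
\<close>
lemma linearized_step_estimate:
  fixes f :: "real ^ 'n \<Rightarrow> ereal" and A :: "real ^ 'n ^ 'm" and M :: "real ^ 'n ^ 'n"
  assumes sc: "strongly_convex \<sigma> f"
    and h: "\<And>x. GDERIV h x :> gh x" "convex_on UNIV h" "L-lipschitz_on UNIV gh"
    and L: "L \<le> \<tau> * L"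
    and min: "is_arg_min (\<lambda>\<xi>. f \<xi> + ereal (gh z \<bullet> \<xi> + l \<bullet> (A *v \<xi> - b)
        + \<tau> * \<rho> * ((A *v z - b) \<bullet> (A *v \<xi>)) + \<tau> / 2 * ((\<xi> - z) \<bullet> (M *v (\<xi> - z))))) (\<lambda>_. True) p"
    and fp: "f p = ereal a" and fx: "f x = ereal d" and x: "A *v x = b"
  defines "P \<equiv> M - \<rho> *\<^sub>R (transpose A ** A)"
  shows "a + h p + l \<bullet> (A *v p - b) + \<tau> * \<rho> / 2 * (norm (A *v p - b))\<^sup>2 - (d + h x)
    \<le> \<tau> / 2 * ((x - z) \<bullet> (P *v (x - z)) - (x - p) \<bullet> (P *v (x - p)))
      - \<tau> / 2 * ((p - z) \<bullet> ((P - L *\<^sub>R mat 1) *v (p - z)))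
      - \<sigma> / 2 * (norm (x - p))\<^sup>2 - \<tau> * \<rho> / 2 * (norm (A *v p - b))\<^sup>2"
proof -
  define r where "r = A *v z - b"
  define r' where "r' = A *v p - b"
  define c where "c = gh z + transpose A *v (l + (\<tau> * \<rho>) *\<^sub>R r)"
  have adj: "(transpose A *v y) \<bullet> v = y \<bullet> (A *v v)" for y :: "real ^ 'm" and v
    by (simp add: dot_lmul_matrix)
  have c: "c \<bullet> v = gh z \<bullet> v + l \<bullet> (A *v v) + \<tau> * \<rho> * (r \<bullet> (A *v v))" for v
    unfolding c_def inner_add_left adj by simp
  define m where "m v = v \<bullet> (M *v v)" for v
  have growth: "a - d \<le> c \<bullet> (x - p) + \<tau> / 2 * (m (x - z) - m (p - z) - m (x - p))
      - \<sigma> / 2 * (norm (x - p))\<^sup>2"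
    unfolding m_def
  proof (rule proximal_three_point[OF sc _ fp fx])
    show "is_arg_min (\<lambda>x. f x + ereal (c \<bullet> x + - (l \<bullet> b)
        + \<tau> / 2 * ((x - z) \<bullet> (M *v (x - z))))) (\<lambda>_. True) p"
      using min by (simp add: c r_def inner_diff_right algebra_simps)
  qed
  have lin: "c \<bullet> (x - p) = gh z \<bullet> (x - p) - l \<bullet> r' - \<tau> * \<rho> * (r \<bullet> r')"
    by (simp add: c r'_def matrix_vector_mult_diff_distrib x inner_diff_right algebra_simps)
  have smooth: "h p - h x \<le> - (gh z \<bullet> (x - p)) + \<tau> * L / 2 * (norm (p - z))\<^sup>2"
  proof -
    have "L / 2 * (norm (p - z))\<^sup>2 \<le> \<tau> * L / 2 * (norm (p - z))\<^sup>2"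
      using L by (intro mult_right_mono) auto
    then show ?thesis
      using linearization_error[OF h, of p x z] by (simp add: inner_diff_right)
  qed
  have P: "v \<bullet> (P *v v) = m v - \<rho> * (norm (A *v v))\<^sup>2" for v
    by (simp add: P_def m_def matrix_vector_mult_diff_rdistrib inner_diff_right inner_gram
        scaleR_matrix_vector_assoc[symmetric])
  have Q: "(p - z) \<bullet> ((P - L *\<^sub>R mat 1) *v (p - z))
      = (p - z) \<bullet> (P *v (p - z)) - L * (norm (p - z))\<^sup>2"
    by (simp add: matrix_vector_mult_diff_rdistrib inner_diff_right[of _ "P *v _"]
        scaleR_matrix_vector_assoc[symmetric] power2_norm_eq_inner)
  have res: "norm (A *v (x - z)) = norm r" "norm (A *v (x - p)) = norm r'"
    by (simp_all add: matrix_vector_mult_diff_distrib x r_def r'_def norm_minus_commute)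
  have cross: "(norm (A *v (p - z)))\<^sup>2 = (norm r')\<^sup>2 - 2 * (r \<bullet> r') + (norm r)\<^sup>2"
  proof -
    have "A *v (p - z) = r' - r"
      by (simp add: matrix_vector_mult_diff_distrib r_def r'_def)
    then show ?thesis
      by (simp add: power2_norm_eq_inner inner_diff_left inner_diff_right inner_commute)
  qed
  show ?thesis
    using growth smooth unfolding r'_def[symmetric] Q P res cross lin
    by (simp add: algebra_simps add_divide_distrib diff_divide_distrib)
qed

theorem lemma5p12:
  fixes f :: "real ^ 'n \<Rightarrow> ereal" and h :: "real ^ 'n \<Rightarrow> real"
    and gh :: "real ^ 'n \<Rightarrow> real ^ 'n"
    and A :: "real ^ 'n ^ 'm" and b :: "real ^ 'm"
    and \<sigma> L \<rho> t :: real and M :: "real ^ 'n ^ 'n"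
  assumes "\<sigma> \<ge> 0"
    and "proper_fun f" and "lower_semicont f" and "strongly_convex \<sigma> f"
    and "convex_on UNIV h"
    and "\<And>x. GDERIV h x :> gh x" and "continuous_on UNIV gh" and "L-lipschitz_on UNIV gh"
    and "has_saddle_point f h A b"
    and "\<rho> > 0" and "t > 0"
    and "\<sigma> > 0 \<and> L > 0 \<longrightarrow> t \<ge> 1"
    and "loewner_ge M (\<rho> *\<^sub>R (transpose A ** A) + L *\<^sub>R mat 1)"
  shows "nice_with f h A b \<sigma> \<rho> t (prim_linearized f gh A b \<sigma> \<rho> t M) 1
           (M - \<rho> *\<^sub>R (transpose A ** A))
           (M - \<rho> *\<^sub>R (transpose A ** A) - L *\<^sub>R mat 1)"
proof -
  let ?r = "rho_t \<sigma> \<rho> t" and ?\<tau> = "tau_t \<sigma> t"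
  define P where "P = M - \<rho> *\<^sub>R (transpose A ** A)"
  define Q where "Q = P - L *\<^sub>R mat 1"
  have L0: "0 \<le> L" using assms(8) by (rule lipschitz_on_nonneg)
  have r: "?r = ?\<tau> * \<rho>" by (simp add: rho_t_def tau_t_def)
  have L: "L \<le> ?\<tau> * L"
    using assms(1,12) L0 by (cases "L = 0") (auto simp: tau_t_def)
  have psdQ: "psd Q"
    using assms(13) by (simp add: loewner_ge_def Q_def P_def diff_diff_eq)
  have psdP: "psd P"
    using psd_add[OF psdQ psd_scaleR[OF L0 psd_mat_1]] by (simp add: Q_def)
  have psdM: "psd M"
    using psd_add[OF psdP psd_scaleR[OF _ psd_gram, of \<rho> A]] assms(10) by (simp add: P_def)
  have "aug_lagrangian f h A b ?r p l - aug_lagrangian f h A b ?r x l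
      \<le> ereal (?\<tau> * Delta P x z p - ?\<tau> / 2 * (mnorm Q (p - z))\<^sup>2
          - \<sigma> / 2 * (norm (x - p))\<^sup>2 - 1 * ?r / 2 * (norm (A *v p - b))\<^sup>2)"
    if p: "p \<in> prim_linearized f gh A b \<sigma> \<rho> t M z l" and x: "x \<in> feasible A b" for z l p x
  proof -
    have min: "is_arg_min (\<lambda>\<xi>. f \<xi> + ereal (gh z \<bullet> \<xi> + l \<bullet> (A *v \<xi> - b)
        + ?\<tau> * \<rho> * ((A *v z - b) \<bullet> (A *v \<xi>)) + ?\<tau> / 2 * ((\<xi> - z) \<bullet> (M *v (\<xi> - z))))) (\<lambda>_. True) p"
      using p by (simp add: prim_linearized_def r psd_mnorm_sq[OF psdM])
    obtain a where a: "f p = ereal a"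
      using arg_min_proper_finite[OF assms(2) min] by (cases "f p") auto
    have Ax: "A *v x = b" using x by (simp add: feasible_def)
    show ?thesis
    proof (cases "f x")
      case (real d)
      show ?thesis
        using linearized_step_estimate[OF assms(4) assms(6,5,8) L min a real Ax]
        by (simp add: aug_lagrangian_def Delta_def a real Ax psd_mnorm_sq[OF psdP]
            psd_mnorm_sq[OF psdQ] P_def[symmetric] Q_def[symmetric] r)
    next
      case PInf
      then show ?thesis by (simp add: aug_lagrangian_def a)
    next
      case MInf
      then show ?thesis using assms(2) by (simp add: proper_fun_def)
    qed
  qed
  then show ?thesis
    unfolding nice_with_def P_def[symmetric] Q_def[symmetric] using psdP psdQ by simp
qed

end
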